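(* Let $f\colon\mathbb{R}^n\to\mathbb{R}$ be convex and coordinate-wise $L$-smooth, and let $\tau_{\rm UCD},\tau_{\rm SCD},\tau_{\rm ASCD}$ denote the (bounds on the) expected one step progress of UCD, SCD and ASCD, respectively, as defined in the context, all methods using the same update rule $\mathcal{M}$. Then for every $x\in\mathbb{R}^n$ (for ASCD: whenever the algorithm is at iterate $x$, in any iteration of any run), $$\tau_{\rm UCD}(x)\le\tau_{\rm ASCD}(x)\le\tau_{\rm SCD}(x).$$
   Context: Write $e_i$ for the standard unit vectors of $\mathbb{R}^n$, $[n]=\{1,\dots,n\}$, $[x]_i$ for the $i$-th coordinate of $x$, and $\nabla_i f$ for the $i$-th component of $\nabla f$. A differentiable $f$ is coordinate-wise $L$-smooth ($L>0$) if $|\nabla_i f(x+\eta e_i)-\nabla_i f(x)|\le L|\eta|$ for all $x\in\mathbb{R}^n$, $\eta\in\mathbb{R}$, $i\in[n]$. A $\delta$-gradient oracle is a family of functions $g_{ij}\colon\mathbb{R}^n\to\mathbb{R}$ with errors $\delta_{ij}\in[0,\infty]$ ($i,j\in[n]$) such that $|\nabla_j f(x+\gamma e_i)-\nabla_j f(x)-\gamma g_{ij}(x)|\le|\gamma|\delta_{ij}$ for all $x\in\mathbb{R}^n$, $\gamma\in\mathbb{R}$ (convention $0\cdot\infty=0$). A coordinate update rule $\mathcal{M}$ takes the current iterate $x_t$ and the active coordinate $i_t$ with $\nabla_{i_t}f(x_t)$, and returns $(x_{t+1},\tilde g,r)$ where $x_{t+1}$ differs from $x_t$ at most in coordinate $i_t$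 and $|\nabla_{i_t}f(x_{t+1})-\tilde g|\le r$. ASCD (approximate steepest coordinate descent): input $f$, an arbitrary starting point $x_0$, a $\delta$-gradient oracle and a rule $\mathcal{M}$. Initialize $[\tilde g_0]_i=0$, $[r_0]_i=\infty$ for $i\in[n]$. For $t=0,1,2,\dots$: 1. For $i\in[n]$ set $[u_t]_i:=\max\{|[\tilde g_t]_i-[r_t]_i|,\,|[\tilde g_t]_i+[r_t]_i|\}$ and $[\ell_t]_i:=\min\{|y| : y\in\mathbb{R},\ [\tilde g_t]_i-[r_t]_i\le y\le[\tilde g_t]_i+[r_t]_i\}$. 2. For nonempty $\mathcal{I}\subseteq[n]$ put $\operatorname{av}(\mathcal{I}):=\frac1{|\mathcal{I}|}\sum_{i\in\mathcal{I}}[\ell_t]_i^2$. The active set $\mathcal{I}_t$ is a nonempty set of smallest cardinality among all nonempty $\mathcal{I}\subseteq[n]$ with $[u_t]_i^2<\operatorname{av}(\mathcal{I})$ for all $i\notin\mathcal{I}$. 3. Pick $i_t$ uniformly at random from $\mathcal{I}_t$; let $(x_{t+1},[\tilde g_{t+1}]_{i_t},[r_{t+1}]_{i_t})$ be the output of $\mathcal{M}$. 4. With $\gamma_t:=[x_{t+1}]_{i_t}-[x_t]_{i_t}$, for $j\ne i_t$ set $[\tilde g_{t+1}]_j:=[\tilde g_t]_j+\gamma_t g_{i_tj}(x_t)$ and $[r_{t+1}]_j:=[r_t]_j+|\gamma_t|\delta_{i_tj}$. One step progress: for a method that picks the active coordinate $i$ at iterate $x$ according to some distribution, $\tau(x):=\mathbb{E}_i\big[\frac1{2L}|\nabla_i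 f(x)|^2\big]$. UCD picks $i$ uniformly from $[n]$, so $\tau_{\rm UCD}(x)=\frac1{2nL}\|\nabla f(x)\|_2^2$. SCD picks $i\in\arg\max_{i}|\nabla_i f(x)|$, so $\tau_{\rm SCD}(x)=\frac1{2L}\|\nabla f(x)\|_\infty^2$. For ASCD at iterate $x=x_t$ with active set $\mathcal{I}=\mathcal{I}_t$, $\tau_{\rm ASCD}(x)=\frac1{2L|\mathcal{I}|}\sum_{i\in\mathcal{I}}|\nabla_i f(x)|^2$. *)

theory Defs
  imports "HOL-Probability.Probability"
begin

text \<open>The coordinates \<open>[n]\<close> are the elements of a finite type \<open>'n\<close>, so that
  \<open>n = CARD('n)\<close>, and \<open>axis i 1\<close> is the unit vector \<open>e\<^sub>i\<close>. Quantities in \<open>[0,\<infinity>]\<close> are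
  nonnegative \<^typ>\<open>ereal\<close>s, for which \<open>0 * \<infinity> = 0\<close>.\<close>

definition grad :: "('a::real_inner \<Rightarrow> real) \<Rightarrow> 'a \<Rightarrow> 'a" where
  "grad f x = (THE D. GDERIV f x :> D)"

definition coordwise_smooth :: "real \<Rightarrow> (real^'n \<Rightarrow> real) \<Rightarrow> bool" where
  "coordwise_smooth L f \<longleftrightarrow>
     0 < L \<and> (\<forall>x. f differentiable (at x)) \<and>
     (\<forall>x \<eta> i. \<bar>grad f (x + \<eta> *\<^sub>R axis i 1) $ i - grad f x $ i\<bar> \<le> L * \<bar>\<eta>\<bar>)"

definition gradient_oracle ::
  "(real^'n \<Rightarrow> real) \<Rightarrow> ('n \<Rightarrow> 'n \<Rightarrow> ereal) \<Rightarrow> ('n \<Rightarrow> 'n \<Rightarrow> real^'n \<Rightarrow> real) \<Rightarrow> bool" where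
  "gradient_oracle f \<delta> g \<longleftrightarrow>
     (\<forall>i j. 0 \<le> \<delta> i j) \<and>
     (\<forall>x \<gamma> i j. ereal \<bar>grad f (x + \<gamma> *\<^sub>R axis i 1) $ j - grad f x $ j - \<gamma> * g i j x\<bar>
                  \<le> ereal \<bar>\<gamma>\<bar> * \<delta> i j)"

text \<open>An update rule receives the iterate, the active coordinate and the partial derivative
  there. It is only constrained when the third argument is the actual partial derivative, and
  the radius it returns may be infinite.\<close>

type_synonym 'n update_rule = "real^'n \<Rightarrow> 'n \<Rightarrow> real \<Rightarrow> (real^'n) \<times> real \<times> ereal"

definition coordinate_update_rule :: "(real^'n \<Rightarrow> real) \<Rightarrow> 'n update_rule \<Rightarrow> bool" where
  "coordinate_update_rule f M \<longleftrightarrow>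
     (\<forall>x i. case M x i (grad f x $ i) of (x', g', r') \<Rightarrow>
        (\<forall>j. j \<noteq> i \<longrightarrow> x' $ j = x $ j) \<and> ereal \<bar>grad f x' $ i - g'\<bar> \<le> r')"

definition upper :: "real^'n \<Rightarrow> ereal^'n \<Rightarrow> 'n \<Rightarrow> ereal" where
  "upper g r i = max \<bar>ereal (g $ i) - r $ i\<bar> \<bar>ereal (g $ i) + r $ i\<bar>"

definition lower :: "real^'n \<Rightarrow> ereal^'n \<Rightarrow> 'n \<Rightarrow> real" where
  "lower g r i = (LEAST v. \<exists>y::real. v = \<bar>y\<bar> \<and>
     ereal (g $ i) - r $ i \<le> ereal y \<and> ereal y \<le> ereal (g $ i) + r $ i)"

definition av :: "real^'n \<Rightarrow> ereal^'n \<Rightarrow> 'n set \<Rightarrow> real" where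
  "av g r I = (\<Sum>i\<in>I. (lower g r i)\<^sup>2) / real (card I)"

definition active_set :: "real^'n \<Rightarrow> ereal^'n \<Rightarrow> 'n set \<Rightarrow> bool" where
  "active_set g r I \<longleftrightarrow>
     is_arg_min card (\<lambda>J. J \<noteq> {} \<and> (\<forall>i. i \<notin> J \<longrightarrow> (upper g r i)\<^sup>2 < ereal (av g r J))) I"

text \<open>The distributions of the active coordinate. The tie-break of \<open>ARG_MAX\<close> does not affect
  the one step progress.\<close>

definition ucd_choice :: "'n::finite pmf" where
  "ucd_choice = pmf_of_set UNIV"

definition scd_choice :: "(real^'n \<Rightarrow> real) \<Rightarrow> real^'n \<Rightarrow> 'n pmf" where
  "scd_choice f x = return_pmf (ARG_MAX (\<lambda>i. \<bar>grad f x $ i\<bar>) i. True)"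

definition ascd_choice :: "'n set \<Rightarrow> 'n pmf" where
  "ascd_choice I = pmf_of_set I"

text \<open>A run consists of the iterates \<open>x\<close>, the gradient estimates \<open>g'\<close> with radii \<open>r'\<close>, the
  active sets \<open>I\<close> and the sampled coordinates \<open>k\<close>. The runs are the possible realisations of
  the randomised algorithm, for any choice among active sets of equal cardinality.\<close>

definition ascd_run ::
  "(real^'n \<Rightarrow> real) \<Rightarrow> ('n \<Rightarrow> 'n \<Rightarrow> ereal) \<Rightarrow> ('n \<Rightarrow> 'n \<Rightarrow> real^'n \<Rightarrow> real) \<Rightarrow> 'n update_rule \<Rightarrow>
   (nat \<Rightarrow> real^'n) \<Rightarrow> (nat \<Rightarrow> real^'n) \<Rightarrow> (nat \<Rightarrow> ereal^'n) \<Rightarrow> (nat \<Rightarrow> 'n set) \<Rightarrow> (nat \<Rightarrow> 'n) \<Rightarrow> bool"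
where
  "ascd_run f \<delta> g M x g' r' I k \<longleftrightarrow>
     (\<forall>j. g' 0 $ j = 0 \<and> r' 0 $ j = \<infinity>) \<and>
     (\<forall>t. active_set (g' t) (r' t) (I t) \<and>
          k t \<in> set_pmf (ascd_choice (I t)) \<and>
          (x (Suc t), g' (Suc t) $ k t, r' (Suc t) $ k t) = M (x t) (k t) (grad f (x t) $ k t) \<and>
          (let \<gamma> = x (Suc t) $ k t - x t $ k t in
             \<forall>j. j \<noteq> k t \<longrightarrow>
               g' (Suc t) $ j = g' t $ j + \<gamma> * g (k t) j (x t) \<and>
               r' (Suc t) $ j = r' t $ j + ereal \<bar>\<gamma>\<bar> * \<delta> (k t) j))"

definition one_step_progress :: "real \<Rightarrow> (real^'n \<Rightarrow> real) \<Rightarrow> 'n pmf \<Rightarrow> real^'n \<Rightarrow> real" where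
  "one_step_progress L f p x =
     measure_pmf.expectation p (\<lambda>i. 1 / (2 * L) * \<bar>grad f x $ i\<bar>\<^sup>2)"

definition tau_UCD :: "real \<Rightarrow> (real^'n \<Rightarrow> real) \<Rightarrow> real^'n \<Rightarrow> real" where
  "tau_UCD L f x = one_step_progress L f ucd_choice x"

definition tau_SCD :: "real \<Rightarrow> (real^'n \<Rightarrow> real) \<Rightarrow> real^'n \<Rightarrow> real" where
  "tau_SCD L f x = one_step_progress L f (scd_choice f x) x"

definition tau_ASCD :: "real \<Rightarrow> (real^'n \<Rightarrow> real) \<Rightarrow> 'n set \<Rightarrow> real^'n \<Rightarrow> real" where
  "tau_ASCD L f I x = one_step_progress L f (ascd_choice I) x"

lemma GDERIV_grad:
  fixes f :: "real^'n \<Rightarrow> real"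
  assumes "f differentiable (at x)"
  shows "GDERIV f x :> grad f x"
proof -
  obtain f' where f': "(f has_derivative f') (at x)"
    using assms by (auto simp: differentiable_def)
  interpret linear f' using f' by (rule has_derivative_linear)
  define D where "D = (\<chi> i. f' (axis i 1))"
  have f'_eq: "f' h = h \<bullet> D" for h
  proof -
    have "f' h = f' (\<Sum>i\<in>UNIV. h $ i *\<^sub>R axis i 1)"
      by (simp add: basis_expansion[of h, unfolded scalar_mult_eq_scaleR])
    also have "\<dots> = h \<bullet> D" by (simp add: sum scale D_def inner_vec_def)
    finally show ?thesis .
  qed
  then have D: "GDERIV f x :> D"
    using f' by (simp add: gderiv_def f'_eq[abs_def])
  show ?thesis unfolding grad_def
  proof (rule theI[where P = "\<lambda>D. GDERIV f x :> D" and a = D])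
    show "GDERIV f x :> D" by (rule D)
  next
    fix E assume "GDERIV f x :> E"
    with D have "(\<lambda>h. h \<bullet> E) = (\<lambda>h. h \<bullet> D)"
      unfolding gderiv_def by (metis has_derivative_unique)
    then have "\<forall>h. h \<bullet> E = h \<bullet> D" by (simp add: fun_eq_iff)
    then show "E = D" by (rule vector_eq_ldot[THEN iffD1])
  qed
qed

text \<open>The closed forms of the three quantities.\<close>

lemma tau_UCD_eq:
  fixes f :: "real^'n \<Rightarrow> real"
  shows "tau_UCD L f x = (norm (grad f x))\<^sup>2 / (2 * real CARD('n) * L)"
proof -
  have "(norm (grad f x))\<^sup>2 = (\<Sum>i\<in>UNIV. \<bar>grad f x $ i\<bar>\<^sup>2)"
    by (simp add: norm_vec_def L2_set_def sum_nonneg)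
  then show ?thesis
    by (simp add: tau_UCD_def one_step_progress_def ucd_choice_def integral_pmf_of_set
        sum_divide_distrib[symmetric] mult_ac)
qed

lemma tau_ASCD_eq:
  fixes f :: "real^'n \<Rightarrow> real"
  assumes "I \<noteq> {}"
  shows "tau_ASCD L f I x = 1 / (2 * L * real (card I)) * (\<Sum>i\<in>I. \<bar>grad f x $ i\<bar>\<^sup>2)"
  using assms
  by (simp add: tau_ASCD_def one_step_progress_def ascd_choice_def integral_pmf_of_set
        sum_divide_distrib[symmetric])

lemma tau_SCD_eq:
  fixes f :: "real^'n \<Rightarrow> real"
  shows "tau_SCD L f x = 1 / (2 * L) * (infnorm (grad f x))\<^sup>2"
proof -
  let ?a = "\<lambda>i. \<bar>grad f x $ i\<bar>"
  define m where "m = (ARG_MAX ?a i. True)"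
  have "Max (range ?a) \<in> range ?a" by (rule Max_in) auto
  then obtain k where k: "?a k = Max (range ?a)" by (auto simp only: image_iff)
  then have "is_arg_max ?a (\<lambda>_. True) k"
    by (simp add: is_arg_max_linorder)
  then have "is_arg_max ?a (\<lambda>_. True) m"
    unfolding m_def arg_max_def by (rule someI[where P = "is_arg_max ?a (\<lambda>_. True)"])
  then have m: "?a i \<le> ?a m" for i by (auto simp: is_arg_max_linorder)
  have "infnorm (grad f x) = ?a m"
    unfolding infnorm_cart by (rule cSup_eq_maximum) (use m in auto)
  then show ?thesis
    by (simp add: tau_SCD_def one_step_progress_def scd_choice_def m_def)
qed

end

theory Submission
  imports Defs
begin

text \<open>Along every run the intervals \<open>[g'\<^sub>i - r'\<^sub>i, g'\<^sub>i + r'\<^sub>i]\<close> contain the partial derivatives,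
  so \<open>lower\<close> and \<open>upper\<close> bound their absolute values. Hence every squared partial derivative
  outside the active set lies below the average of the squared partial derivatives over the
  active set, and enlarging the active set to all coordinates can only decrease the average.\<close>

lemma ereal_abs_diff_le_iff:
  "ereal \<bar>a - b\<bar> \<le> r \<longleftrightarrow> ereal b - r \<le> ereal a \<and> ereal a \<le> ereal b + r"
  by (cases r) auto

text \<open>The endpoint of the interval farther from 0 dominates all its points; an infinite radius
  makes the bound infinite.\<close>

lemma abs_le_upper:
  assumes "ereal \<bar>a - g $ i\<bar> \<le> r $ i"
  shows "ereal \<bar>a\<bar> \<le> upper g r i"
  using assms unfolding upper_def
  by (cases "r $ i") (auto simp: max_def)

text \<open>\<open>LEAST\<close> over the reals says something only if the minimum is attained. It
  is, since the interval is closed and \<open>a\<close> makes it nonempty: its point nearest to 0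
  realises \<open>lower\<close>.\<close>

lemma lower_bounds:
  assumes "ereal \<bar>a - g $ i\<bar> \<le> r $ i"
  shows "0 \<le> lower g r i" "lower g r i \<le> \<bar>a\<bar>"
proof -
  define S where "S = {y. ereal \<bar>y - g $ i\<bar> \<le> r $ i}"
  \<comment> \<open>A finite radius gives a closed ball; the infinite ones give the whole line or
    the empty set.\<close>
  have "closed S"
  proof (cases "r $ i")
    case (real \<rho>)
    then have "S = cball (g $ i) \<rho>"
      by (auto simp: S_def dist_real_def abs_minus_commute)
    then show ?thesis by simp
  qed (simp_all add: S_def)
  moreover have "a \<in> S"
    using assms by (simp add: S_def)
  ultimately obtain y where y: "y \<in> S" "\<And>z. z \<in> S \<Longrightarrow> \<bar>y\<bar> \<le> \<bar>z\<bar>"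
    using distance_attains_inf[of S 0] by (auto simp: dist_real_def)
  have "lower g r i = (LEAST v. \<exists>z. v = \<bar>z\<bar> \<and> z \<in> S)"
    by (simp add: lower_def S_def ereal_abs_diff_le_iff)
  also have "\<dots> = \<bar>y\<bar>"
    by (rule Least_equality) (use y in auto)
  finally show "0 \<le> lower g r i" "lower g r i \<le> \<bar>a\<bar>"
    using y(2)[OF \<open>a \<in> S\<close>] by simp_all
qed

text \<open>Infinite initial radii make the start trivial. In a step, the active coordinate inherits
  the guarantee of \<open>M\<close>; every other radius grows by the error bound of the
  oracle.\<close>

lemma ascd_run_interval:
  assumes orc: "gradient_oracle f \<delta> g"
    and rule: "coordinate_update_rule f M"
    and run: "ascd_run f \<delta> g M x g' r' I k"
  shows "ereal \<bar>grad f (x t) $ j - g' t $ j\<bar> \<le> r' t $ j"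
proof (induction t arbitrary: j)
  case 0
  then show ?case using run by (simp add: ascd_run_def)
next
  case (Suc t)
  let ?i = "k t"
  define \<gamma> where "\<gamma> = x (Suc t) $ ?i - x t $ ?i"
  have out: "M (x t) ?i (grad f (x t) $ ?i) = (x (Suc t), g' (Suc t) $ ?i, r' (Suc t) $ ?i)"
    and step: "\<And>j. j \<noteq> ?i \<Longrightarrow> g' (Suc t) $ j = g' t $ j + \<gamma> * g ?i j (x t) \<and>
        r' (Suc t) $ j = r' t $ j + ereal \<bar>\<gamma>\<bar> * \<delta> ?i j"
    using run unfolding ascd_run_def Let_def \<gamma>_def by metis+
  \<comment> \<open>The run feeds \<open>M\<close> the true partial derivative, the input for which
    its output is constrained.\<close>
  note rule[unfolded coordinate_update_rule_def, 
      THEN spec[where x = "x t"], THEN spec[where x = ?i]]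
  then have upd: "\<And>j. j \<noteq> ?i \<Longrightarrow> x (Suc t) $ j = x t $ j"
    and act: "ereal \<bar>grad f (x (Suc t)) $ ?i - g' (Suc t) $ ?i\<bar> \<le> r' (Suc t) $ ?i"
    unfolding out by simp_all
  show ?case
  proof (cases "j = ?i")
    case True
    then show ?thesis using act by simp
  next
    case False
    let ?d = "grad f (x (Suc t)) $ j - grad f (x t) $ j - \<gamma> * g ?i j (x t)"
    \<comment> \<open>Only the active coordinate moves, so the step has the axis-parallel form that
      the oracle bound covers.\<close>
    have "x (Suc t) = x t + \<gamma> *\<^sub>R axis ?i 1"
      using upd by (auto simp: vec_eq_iff axis_def \<gamma>_def)
    then have "ereal \<bar>?d\<bar> \<le> ereal \<bar>\<gamma>\<bar> * \<delta> ?i j"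
      using orc by (simp add: gradient_oracle_def)
    with Suc.IH have "ereal \<bar>grad f (x t) $ j - g' t $ j\<bar> + ereal \<bar>?d\<bar> \<le> r' (Suc t) $ j"
      unfolding step[OF False, THEN conjunct2] by (rule add_mono)
    \<comment> \<open>The new residual is the old one plus \<open>?d\<close>.\<close>
    moreover have "\<bar>grad f (x (Suc t)) $ j - g' (Suc t) $ j\<bar>
        \<le> \<bar>grad f (x t) $ j - g' t $ j\<bar> + \<bar>?d\<bar>"
      using step[OF False] by linarith
    then have "ereal \<bar>grad f (x (Suc t)) $ j - g' (Suc t) $ j\<bar>
        \<le> ereal \<bar>grad f (x t) $ j - g' t $ j\<bar> + ereal \<bar>?d\<bar>"
      by simp
    ultimately show ?thesis by (rule order_trans[rotated])
  qed
qed

text \<open>The terms in \<open>I\<close> sum to \<open>card I\<close> times their average, and each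
  remaining term adds at most that average.\<close>

lemma sum_le_card_mult_average:
  fixes h :: "'n::finite \<Rightarrow> real"
  assumes "I \<noteq> {}" and "\<And>i. i \<notin> I \<Longrightarrow> h i \<le> sum h I / card I"
  shows "sum h UNIV \<le> CARD('n) * (sum h I / card I)"
proof -
  have "card I \<noteq> 0" using assms(1) by simp
  have "sum h UNIV = sum h I + sum h (- I)"
    by (metis Compl_eq_Diff_UNIV add.commute finite sum.subset_diff top_greatest)
  also have "\<dots> \<le> sum h I + card (- I) * (sum h I / card I)"
    using assms(2) by (intro add_left_mono sum_bounded_above) simp
  also have "\<dots> = (card I + card (- I)) * (sum h I / card I)"
    using \<open>card I \<noteq> 0\<close> by (simp add: add_divide_distrib distrib_right)
  also have "card I + card (- I) = CARD('n)"
    by (metis Compl_partition Compl_disjoint card_Un_disjoint finite)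
  finally show ?thesis .
qed

theorem theorem3p2:
  fixes f :: "real^'n \<Rightarrow> real"
    and L :: real
    and \<delta> :: "'n \<Rightarrow> 'n \<Rightarrow> ereal"
    and g :: "'n \<Rightarrow> 'n \<Rightarrow> real^'n \<Rightarrow> real"
    and M :: "'n update_rule"
    and x g' :: "nat \<Rightarrow> real^'n"
    and r' :: "nat \<Rightarrow> ereal^'n"
    and I :: "nat \<Rightarrow> 'n set"
    and k :: "nat \<Rightarrow> 'n"
    and t :: nat
  assumes "convex_on UNIV f"
    and "coordwise_smooth L f"
    and "gradient_oracle f \<delta> g"
    and "coordinate_update_rule f M"
    and "ascd_run f \<delta> g M x g' r' I k"
  shows "tau_UCD L f (x t) \<le> tau_ASCD L f (I t) (x t)
    \<and> tau_ASCD L f (I t) (x t) \<le> tau_SCD L f (x t)"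
proof -
  define h where "h i = \<bar>grad f (x t) $ i\<bar>\<^sup>2" for i
  let ?A = "sum h (I t) / card (I t)"
  have L: "0 < L" using assms(2) by (simp add: coordwise_smooth_def)
  have "active_set (g' t) (r' t) (I t)"
    using assms(5) by (simp add: ascd_run_def)
  then have ne: "I t \<noteq> {}"
    and dom: "\<And>i. i \<notin> I t \<Longrightarrow> (upper (g' t) (r' t) i)\<^sup>2 < ereal (av (g' t) (r' t) (I t))"
    by (simp_all add: active_set_def is_arg_min_def)
  have card: "0 < card (I t)" using ne by (simp add: card_gt_0_iff)
  note int = ascd_run_interval[OF assms(3-5), of t]
  have av_le: "av (g' t) (r' t) (I t) \<le> ?A"
    unfolding av_def h_def
    by (intro divide_right_mono sum_mono power_mono lower_bounds[OF int]) simp_all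
  have out: "h i \<le> ?A" if "i \<notin> I t" for i
  proof -
    have "ereal (h i) = (ereal \<bar>grad f (x t) $ i\<bar>)\<^sup>2" by (simp add: h_def)
    \<comment> \<open>Monotonicity of the extended product needs \<open>upper\<close> nonnegative,
      which follows by transitivity through the absolute value.\<close>
    also have "\<dots> \<le> (upper (g' t) (r' t) i)\<^sup>2"
      unfolding power2_eq_square
      by (intro ereal_mult_mono abs_le_upper[OF int] order_trans[OF _ abs_le_upper[OF int]]) simp_all
    also have "\<dots> \<le> ereal (av (g' t) (r' t) (I t))" using dom[OF that] by simp
    finally show ?thesis using av_le by simp
  qed
  have ascd: "tau_ASCD L f (I t) (x t) = ?A / (2 * L)"
    by (simp add: tau_ASCD_eq[OF ne] h_def)
  have "(norm (grad f (x t)))\<^sup>2 = sum h UNIV"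
    by (simp add: h_def norm_vec_def L2_set_def sum_nonneg)
  then have ucd: "tau_UCD L f (x t) = sum h UNIV / CARD('n) / (2 * L)"
    by (simp add: tau_UCD_eq)
  have scd: "tau_SCD L f (x t) = (infnorm (grad f (x t)))\<^sup>2 / (2 * L)"
    by (simp add: tau_SCD_eq)
  have "sum h UNIV / CARD('n) \<le> ?A"
    using sum_le_card_mult_average[OF ne out]
    by (simp add: pos_divide_le_eq mult.commute)
  \<comment> \<open>An average never exceeds the largest term, here bounded by the squared maximum
    norm.\<close>
  moreover have "sum h (I t) \<le> card (I t) * (infnorm (grad f (x t)))\<^sup>2"
    unfolding h_def
    by (intro sum_bounded_above power_mono component_le_infnorm_cart) simp
  then have "?A \<le> (infnorm (grad f (x t)))\<^sup>2"
    using card by (simp add: pos_divide_le_eq mult.commute)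
  ultimately show ?thesis
    unfolding ucd ascd scd by (intro conjI divide_right_mono) (use L in simp_all)
qed

end
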